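(* Let $G$ be a connected strongly regular graph with parameters $(n,k,2,\mu)$, with $k\geq 3$, such that each vertex of $G$ is the central vertex of exactly one wheel in $G$. Then every eigenvalue of the adjacency matrix of the anti-Gallai graph $\Delta(G)$ lies in $[-4,4]$, and the eigenvalues of the semi-total point graph $R(C_k)$ interlace those of $\Delta(G)$.
   Context: All graphs are finite and simple; eigenvalues are those of the adjacency matrix. A $k$-regular graph $G$ on $n$ vertices is strongly regular with parameters $(n,k,\lambda,\mu)$ if $G$ is neither complete nor empty, any two adjacent vertices have exactly $\lambda$ common neighbours, and any two non-adjacent vertices have exactly $\mu$ common neighbours. The wheel $W_m$ is obtained by joining a central vertex to all vertices of a cycle $C_m$; a wheel in $G$ with central vertex $u$ is a (not necessarily induced) subgraph of $G$ isomorphic to some $W_m$ with $u$ as centre. The anti-Gallai graph $\Delta(G)$ has the edges of $G$ as vertices, two being adjacent iff the corresponding edges lie on a common triangle of $G$. The semi-total point graph $R(H)$ of a graph $H$ is obtained from $H$ by adding, for each edge of $H$, a new vertex adjacent to the two endpoints of that edge; $C_k$ is the cycle on $k$ vertices. If $\alpha_1\leq\dots\leq\alpha_N$ and $\beta_1\leq\dots\leq\beta_M$ with $M<N$, the $\beta$'s interlace the $\alpha$'s if $\alpha_i\leq\beta_i\leq\alpha_{i+N-M}$ for $i=1,\dots,M$. *)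

theory Defs
  imports "Jordan_Normal_Form.Char_Poly"
begin

record 'a ugraph =
  verts :: "'a set"
  edges :: "'a set set"

definition simple_graph :: "'a ugraph \<Rightarrow> bool" where
  "simple_graph G \<longleftrightarrow> finite (verts G) \<and> (\<forall>e\<in>edges G. e \<subseteq> verts G \<and> card e = 2)"

definition adjacent :: "'a ugraph \<Rightarrow> 'a \<Rightarrow> 'a \<Rightarrow> bool" where
  "adjacent G x y \<longleftrightarrow> {x, y} \<in> edges G"

definition neighbours :: "'a ugraph \<Rightarrow> 'a \<Rightarrow> 'a set" where
  "neighbours G x = {y \<in> verts G. adjacent G x y}"

definition regular_graph :: "'a ugraph \<Rightarrow> nat \<Rightarrow> bool" where
  "regular_graph G k \<longleftrightarrow> (\<forall>x\<in>verts G. card (neighbours G x) = k)"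

definition complete_graph :: "'a ugraph \<Rightarrow> bool" where
  "complete_graph G \<longleftrightarrow> (\<forall>x\<in>verts G. \<forall>y\<in>verts G. x \<noteq> y \<longrightarrow> adjacent G x y)"

definition empty_graph :: "'a ugraph \<Rightarrow> bool" where
  "empty_graph G \<longleftrightarrow> edges G = {}"

definition connected_graph :: "'a ugraph \<Rightarrow> bool" where
  "connected_graph G \<longleftrightarrow> verts G \<noteq> {} \<and>
     (\<forall>x\<in>verts G. \<forall>y\<in>verts G. (adjacent G)\<^sup>*\<^sup>* x y)"

definition strongly_regular :: "'a ugraph \<Rightarrow> nat \<Rightarrow> nat \<Rightarrow> nat \<Rightarrow> nat \<Rightarrow> bool" where
  "strongly_regular G n k l m \<longleftrightarrow>
     simple_graph G \<and> card (verts G) = n \<and> regular_graph G k \<and>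
     \<not> complete_graph G \<and> \<not> empty_graph G \<and>
     (\<forall>x\<in>verts G. \<forall>y\<in>verts G. adjacent G x y \<longrightarrow>
        card (neighbours G x \<inter> neighbours G y) = l) \<and>
     (\<forall>x\<in>verts G. \<forall>y\<in>verts G. x \<noteq> y \<and> \<not> adjacent G x y \<longrightarrow>
        card (neighbours G x \<inter> neighbours G y) = m)"

definition subgraph :: "'a ugraph \<Rightarrow> 'a ugraph \<Rightarrow> bool" where
  "subgraph H G \<longleftrightarrow> simple_graph H \<and> verts H \<subseteq> verts G \<and> edges H \<subseteq> edges G"

definition graph_iso :: "('a \<Rightarrow> 'b) \<Rightarrow> 'a ugraph \<Rightarrow> 'b ugraph \<Rightarrow> bool" where
  "graph_iso f G H \<longleftrightarrow> bij_betw f (verts G) (verts H) \<and>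
     (\<forall>x\<in>verts G. \<forall>y\<in>verts G. adjacent G x y \<longleftrightarrow> adjacent H (f x) (f y))"

text \<open>A simple graph, and the cycle on \<open>m\<close> vertices, only for \<open>m \<ge> 3\<close>.\<close>

definition cycle_graph :: "nat \<Rightarrow> nat ugraph" where
  "cycle_graph m = \<lparr>verts = {..<m}, edges = {{i, Suc i mod m} | i. i < m}\<rparr>"

text \<open>The centre of the wheel is \<open>None\<close>.\<close>

definition wheel_graph :: "nat \<Rightarrow> nat option ugraph" where
  "wheel_graph m =
     \<lparr>verts = insert None (Some ` verts (cycle_graph m)),
      edges = (`) Some ` edges (cycle_graph m) \<union> {{None, Some i} | i. i \<in> verts (cycle_graph m)}\<rparr>"

definition wheel_in :: "'a ugraph \<Rightarrow> 'a \<Rightarrow> 'a ugraph \<Rightarrow> bool" where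
  "wheel_in G u H \<longleftrightarrow> subgraph H G \<and>
     (\<exists>m\<ge>3. \<exists>f. graph_iso f (wheel_graph m) H \<and> f None = u)"

text \<open>Triangles are given by their vertex sets.\<close>

definition triangles :: "'a ugraph \<Rightarrow> 'a set set" where
  "triangles G = {T. T \<subseteq> verts G \<and> card T = 3 \<and> (\<forall>x\<in>T. \<forall>y\<in>T. x \<noteq> y \<longrightarrow> adjacent G x y)}"

definition anti_gallai :: "'a ugraph \<Rightarrow> 'a set ugraph" where
  "anti_gallai G =
     \<lparr>verts = edges G,
      edges = {{e, f} | e f. e \<in> edges G \<and> f \<in> edges G \<and> e \<noteq> f \<and>
                 (\<exists>T\<in>triangles G. e \<subseteq> T \<and> f \<subseteq> T)}\<rparr>"

definition semi_total_point :: "'a ugraph \<Rightarrow> ('a + 'a set) ugraph" where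
  "semi_total_point H =
     \<lparr>verts = Inl ` verts H \<union> Inr ` edges H,
      edges = (`) Inl ` edges H \<union> {{Inl x, Inr e} | x e. e \<in> edges H \<and> x \<in> e}\<rparr>"

text \<open>
  Another enumeration of the vertices conjugates the adjacency matrix by a permutation
  matrix, so eigenvalues and characteristic polynomial do not depend on the choice below.
\<close>

definition vertex_list :: "'a ugraph \<Rightarrow> 'a list" where
  "vertex_list G = (SOME xs. distinct xs \<and> set xs = verts G)"

definition adj_matrix :: "'a ugraph \<Rightarrow> real mat" where
  "adj_matrix G = mat (card (verts G)) (card (verts G))
     (\<lambda>(i, j). if adjacent G (vertex_list G ! i) (vertex_list G ! j) then 1 else 0)"

text \<open>
  The eigenvalues with multiplicity, in ascending order. The adjacency matrix is real
  symmetric, so all complex roots of its characteristic polynomial are real and the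
  list has one entry for each vertex.
\<close>

definition graph_eigenvalues :: "'a ugraph \<Rightarrow> real list" where
  "graph_eigenvalues G = sorted_list_of_multiset (proots (char_poly (adj_matrix G)))"

text \<open>
  \<open>interlaces bs as\<close>: the sorted list \<open>bs\<close> interlaces the sorted list \<open>as\<close>
  (indices start at 0).
\<close>

definition interlaces :: "real list \<Rightarrow> real list \<Rightarrow> bool" where
  "interlaces bs as \<longleftrightarrow> sorted bs \<and> sorted as \<and> length bs < length as \<and>
     (\<forall>i<length bs. as ! i \<le> bs ! i \<and> bs ! i \<le> as ! (i + (length as - length bs)))"

end

theory Submission
  imports Defs "Jordan_Normal_Form.Schur_Decomposition"
begin

text \<open>
  Since \<open>\<lambda> = 2\<close>, every edge of \<open>G\<close> lies in two triangles, so \<open>\<Delta>(G)\<close> is 4-regular and its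
  eigenvalues lie in \<open>[-4, 4]\<close>. Also, every neighbourhood of \<open>G\<close> is 2-regular, hence a disjoint
  union of cycles, and each of these is the rim of a wheel; with only one wheel at \<open>u\<close> the
  neighbourhood of \<open>u\<close> is a single cycle \<open>C\<^sub>k\<close>. For \<open>k = 3\<close> the closed neighbourhood of \<open>u\<close> would be a
  complete component, so \<open>k \<ge> 4\<close> and \<open>C\<^sub>k\<close> is triangle-free. Therefore the spokes and rim edges of the
  wheel at \<open>u\<close> induce a copy of \<open>R(C\<^sub>k)\<close> in \<open>\<Delta>(G)\<close>, and Cauchy interlacing applies. The copy is
  proper if \<open>u\<close> is chosen with a non-neighbour.
\<close>

section \<open>Diagonalising real symmetric matrices\<close>

text \<open>The fundamental theorem of algebra yields a complex eigenvalue \<open>z\<close>. Moving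
  the symmetric matrix across the Hermitian product of \<open>?C *\<^sub>v v\<close> with
  \<open>v\<close> gives \<open>z = cnj z\<close>, so \<open>z\<close> is a real root of the
  characteristic polynomial.\<close>

lemma symmetric_mat_real_eigenvalue:
  fixes A :: "real mat"
  assumes A: "A \<in> carrier_mat n n" and sym: "transpose_mat A = A" and n: "n > 0"
  shows "\<exists>e. eigenvalue A e"
proof -
  let ?C = "map_mat complex_of_real A"
  have C: "?C \<in> carrier_mat n n" using A by simp

  have cp: "char_poly ?C = map_poly complex_of_real (char_poly A)"
    by (rule of_real_hom.char_poly_hom[OF A])
  have "degree (char_poly ?C) \<noteq> 0"
    using degree_monic_char_poly[OF C] n by simp
  then obtain z where z: "poly (char_poly ?C) z = 0"
    using fundamental_theorem_of_algebra_alt[of "char_poly ?C"] by (metis degree_pCons_0)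
  then have "eigenvalue ?C z" using eigenvalue_root_char_poly[OF C] by simp
  then obtain v where v: "v \<in> carrier_vec n" "v \<noteq> 0\<^sub>v n" "?C *\<^sub>v v = z \<cdot>\<^sub>v v"
    using C unfolding eigenvalue_def eigenvector_def by auto
  have cv: "conjugate v \<in> carrier_vec n" using v by simp
  have conjC: "conjugate (?C *\<^sub>v v) = ?C *\<^sub>v conjugate v"
    using A v(1) by (intro eq_vecI) (auto simp: scalar_prod_def cnj_sum)
  have "z * (v \<bullet>c v) = (?C *\<^sub>v v) \<bullet>c v" using v cv by simp
  also have "\<dots> = conjugate v \<bullet> (?C *\<^sub>v v)"
    using C v cv by (intro comm_scalar_prod[of _ n]) auto
  also have "\<dots> = (transpose_mat ?C *\<^sub>v conjugate v) \<bullet> v"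
    using transpose_vec_mult_scalar[OF C v(1) cv] by simp
  also have "transpose_mat ?C = ?C" using sym A by (metis map_mat_transpose)
  also have "(?C *\<^sub>v conjugate v) \<bullet> v = (cnj z \<cdot>\<^sub>v conjugate v) \<bullet> v"
    unfolding conjC[symmetric] v(3) by (simp add: conjugate_smult_vec)
  also have "\<dots> = cnj z * (v \<bullet>c v)"
    using v cv by (simp add: comm_scalar_prod[OF cv v(1)])
  finally have "z = cnj z" using v by auto
  then have "z = complex_of_real (Re z)" by (simp add: complex_eq_iff)
  then have "poly (map_poly complex_of_real (char_poly A)) (complex_of_real (Re z)) = 0"
    using z cp by simp
  then have "poly (char_poly A) (Re z) = 0" by simp
  then show ?thesis using eigenvalue_root_char_poly[OF A] by blast
qed

text \<open>Complete \<open>v\<close> to a basis and apply Gram-Schmidt, which leaves the first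
  vector alone; then normalise. The scalar \<open>c\<close> is the reciprocal of the length of
  \<open>v\<close>.\<close>

lemma orthogonal_mat_first_col:
  fixes v :: "real vec"
  assumes v: "v \<in> carrier_vec n" and v0: "v \<noteq> 0\<^sub>v n"
  shows "\<exists>W c. W \<in> carrier_mat n n \<and> transpose_mat W * W = 1\<^sub>m n \<and> col W 0 = c \<cdot>\<^sub>v v"
proof -
  interpret cof_vec_space n "TYPE(real)" .
  define b where "b = basis_completion v"
  define ws where "ws = gram_schmidt n b"
  note bc = basis_completion[OF v v0, folded b_def]
  have n: "n > 0" using v v0 by (cases n) auto
  note gs = gram_schmidt_result[OF bc(2) bc(4) bc(5) ws_def]
  have len: "length ws = n" using gs(4) bc(6) by simp
  have "b = v # tl b" using bc(6,7) n by (cases b) auto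
  then have "hd ws = v" unfolding ws_def using gram_schmidt_hd[OF v] by metis
  then have ws0: "ws ! 0 = v" using len n by (cases ws) auto
  have wsc: "i < n \<Longrightarrow> ws ! i \<in> carrier_vec n" for i using gs(3) len by auto
  have orth: "i < n \<Longrightarrow> j < n \<Longrightarrow> ws ! i \<bullet> ws ! j = 0 \<longleftrightarrow> i \<noteq> j" for i j
    using corthogonalD[OF gs(2), of i j] len by simp
  have pos: "i < n \<Longrightarrow> ws ! i \<bullet> ws ! i > 0" for i
    using orth[of i i] conjugate_square_ge_0_vec[of "ws ! i"]
    by (simp add: order_less_le)
  define c where "c i = 1 / sqrt (ws ! i \<bullet> ws ! i)" for i
  define W where "W = mat_of_cols n (map (\<lambda>i. c i \<cdot>\<^sub>v ws ! i) [0..<n])"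
  have W: "W \<in> carrier_mat n n" unfolding W_def by auto
  have colW: "col W i = c i \<cdot>\<^sub>v ws ! i" if "i < n" for i
    using that wsc by (simp add: W_def)
  have "transpose_mat W * W = 1\<^sub>m n"
  proof (rule eq_matI)
    fix i j assume "i < dim_row (1\<^sub>m n)" "j < dim_col (1\<^sub>m n)"
    then have ij: "i < n" "j < n" by auto
    have "(transpose_mat W * W) $$ (i, j) = col W i \<bullet> col W j"
      using W ij by simp
    also have "\<dots> = c i * c j * (ws ! i \<bullet> ws ! j)"
      using wsc[OF ij(1)] wsc[OF ij(2)] ij by (simp add: colW)
    also have "\<dots> = 1\<^sub>m n $$ (i, j)"
      using orth[OF ij] pos[OF ij(1)] ij by (cases "i = j") (auto simp: c_def)
    finally show "(transpose_mat W * W) $$ (i, j) = 1\<^sub>m n $$ (i, j)" .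
  qed (use W in auto)
  moreover have "col W 0 = c 0 \<cdot>\<^sub>v v" using colW[OF n] ws0 by simp
  ultimately show ?thesis using W by blast
qed

text \<open>Deflation: in an orthonormal basis that starts with an eigenvector, the first column
  vanishes off the diagonal, and by symmetry so does the first row. What remains is a smaller
  symmetric block, to which the induction hypothesis applies.\<close>

lemma symmetric_mat_diagonalize:
  fixes A :: "real mat"
  assumes "A \<in> carrier_mat n n" and "transpose_mat A = A"
  shows "\<exists>P. P \<in> carrier_mat n n \<and> transpose_mat P * P = 1\<^sub>m n \<and>
    diagonal_mat (transpose_mat P * A * P)"
  using assms
proof (induction n arbitrary: A)
  case 0
  then show ?case by (intro exI[of _ "1\<^sub>m 0"]) (auto simp: diagonal_mat_def)
next
  case (Suc n)
  let ?N = "Suc n"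
  note A = Suc.prems(1)
  obtain e where "eigenvalue A e" using symmetric_mat_real_eigenvalue[OF Suc.prems] by auto
  then obtain v where v: "v \<in> carrier_vec ?N" "v \<noteq> 0\<^sub>v ?N" "A *\<^sub>v v = e \<cdot>\<^sub>v v"
    using A unfolding eigenvalue_def eigenvector_def by auto
  obtain W c where W: "W \<in> carrier_mat ?N ?N" and WW: "transpose_mat W * W = 1\<^sub>m ?N"
    and W0: "col W 0 = c \<cdot>\<^sub>v v"
    using orthogonal_mat_first_col[OF v(1,2)] by blast
  have TW: "transpose_mat W \<in> carrier_mat ?N ?N" using W by simp
  define B where "B = transpose_mat W * A * W"
  have B: "B \<in> carrier_mat ?N ?N" unfolding B_def using W A by simp
  have symB: "transpose_mat B = B"
    unfolding B_def using W A Suc.prems(2)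
    by (simp add: transpose_mult[of _ ?N ?N _ ?N] assoc_mult_mat[of _ ?N ?N _ ?N _ ?N])
  \<comment> \<open>As the first column of \<open>W\<close> is an eigenvector, the first column of
    \<open>B\<close> is \<open>e\<close> times that of \<open>transpose_mat W * W\<close>, the
    identity.\<close>
  have B0: "B $$ (i, 0) = (if i = 0 then e else 0)" if i: "i < ?N" for i
  proof -
    have "B = transpose_mat W * (A * W)"
      unfolding B_def using W A by (simp add: assoc_mult_mat[of _ ?N ?N _ ?N _ ?N])
    then have "B $$ (i, 0) = col W i \<bullet> (A *\<^sub>v col W 0)"
      using i W A by (simp add: col_mult2[of A ?N ?N W ?N] mult_mat_vec_def)
    also have "A *\<^sub>v col W 0 = e \<cdot>\<^sub>v col W 0"
      unfolding W0 using A v by (simp add: mult_mat_vec smult_smult_assoc mult.commute)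
    also have "col W i \<bullet> (e \<cdot>\<^sub>v col W 0) = e * (transpose_mat W * W) $$ (i, 0)"
      using i W by simp
    finally show ?thesis unfolding WW using i by simp
  qed
  have B0': "B $$ (0, j) = (if j = 0 then e else 0)" if j: "j < ?N" for j
    using B0[OF j] symB B j by (metis carrier_matD index_transpose_mat(1) zero_less_Suc)
  define A3 where "A3 = mat n n (\<lambda>(i, j). B $$ (Suc i, Suc j))"
  have A3: "A3 \<in> carrier_mat n n" unfolding A3_def by simp
  have symA3: "transpose_mat A3 = A3"
  proof (rule eq_matI)
    fix i j assume "i < dim_row A3" "j < dim_col A3"
    then have ij: "i < n" "j < n" using A3 by auto
    have "B $$ (Suc j, Suc i) = B $$ (Suc i, Suc j)"
      using symB B ij by (metis Suc_less_eq carrier_matD index_transpose_mat(1))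
    then show "transpose_mat A3 $$ (i, j) = A3 $$ (i, j)" using ij by (simp add: A3_def)
  qed (use A3 in auto)
  let ?e = "mat 1 1 (\<lambda>_. e)"
  have Bb: "B = four_block_mat ?e (0\<^sub>m 1 n) (0\<^sub>m n 1) A3"
    by (rule eq_matI) (use B in \<open>auto simp: B0 B0' A3_def\<close>)
  obtain P where P: "P \<in> carrier_mat n n" and PP: "transpose_mat P * P = 1\<^sub>m n"
    and D: "diagonal_mat (transpose_mat P * A3 * P)"
    using Suc.IH[OF A3 symA3] by blast
  have TP: "transpose_mat P \<in> carrier_mat n n" using P by simp
  \<comment> \<open>The diagonalising matrix of the block is bordered by 1, so that it leaves the
    split-off eigenvector fixed.\<close>
  define Q where "Q = four_block_mat (1\<^sub>m 1) (0\<^sub>m 1 n) (0\<^sub>m n 1) P"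
  have Q: "Q \<in> carrier_mat ?N ?N" unfolding Q_def using P by auto
  have TQ: "transpose_mat Q = four_block_mat (1\<^sub>m 1) (0\<^sub>m 1 n) (0\<^sub>m n 1) (transpose_mat P)"
    unfolding Q_def using P
    by (subst transpose_four_block_mat[of _ 1 1 _ n _ n]) (auto simp: transpose_one)
  have QQ: "transpose_mat Q * Q = 1\<^sub>m ?N"
    unfolding TQ unfolding Q_def
    by (subst mult_four_block_mat[of _ 1 1 _ n _ n _ _ 1 _ n])
      (use P PP in \<open>auto intro!: eq_matI\<close>)
  have QBQ: "transpose_mat Q * B * Q = four_block_mat ?e (0\<^sub>m 1 n) (0\<^sub>m n 1) (transpose_mat P * A3 * P)"
    unfolding TQ Bb unfolding Q_def
    using P A3 by (simp add: mult_four_block_mat[of _ 1 1 _ n _ n _ _ 1 _ n])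
  have "transpose_mat (W * Q) * (W * Q) = transpose_mat Q * (transpose_mat W * W) * Q"
    using W Q by (simp add: transpose_mult[of _ ?N ?N _ ?N] assoc_mult_mat[of _ ?N ?N _ ?N _ ?N])
  then have 1: "transpose_mat (W * Q) * (W * Q) = 1\<^sub>m ?N"
    unfolding WW using Q QQ by simp
  have 2: "transpose_mat (W * Q) * A * (W * Q) = transpose_mat Q * B * Q"
    unfolding B_def
    using W Q A by (simp add: transpose_mult[of _ ?N ?N _ ?N] assoc_mult_mat[of _ ?N ?N _ ?N _ ?N])
  have "diagonal_mat (transpose_mat (W * Q) * A * (W * Q))"
    unfolding 2 QBQ using D P A3 unfolding diagonal_mat_def
    by (auto simp: less_Suc_eq_0_disj) blast
  then show ?case using 1 W Q by (intro exI[of _ "W * Q"]) auto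
qed

text \<open>This is A = P diag(e) P^T with P orthogonal, in coordinates: \<open>p _ k\<close> is the
  unit eigenvector for \<open>e k\<close>. Orthonormality is recorded for rows, which Parseval
  needs, and for columns, which is used to read off coordinates in the eigenbasis.\<close>

definition spectral_decomp ::
    "nat \<Rightarrow> (nat \<Rightarrow> nat \<Rightarrow> real) \<Rightarrow> (nat \<Rightarrow> nat \<Rightarrow> real) \<Rightarrow> (nat \<Rightarrow> real) \<Rightarrow> bool" where
  "spectral_decomp n A p e \<longleftrightarrow>
     (\<forall>i<n. \<forall>j<n. A i j = (\<Sum>k<n. p i k * e k * p j k)) \<and>
     (\<forall>i<n. \<forall>j<n. (\<Sum>k<n. p i k * p j k) = (if i = j then 1 else 0)) \<and>
     (\<forall>k<n. \<forall>l<n. (\<Sum>i<n. p i k * p i l) = (if k = l then 1 else 0))"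

text \<open>Permuting the eigenvectors serves twice: to sort the eigenvalues, and later to reverse
  their order after a change of sign.\<close>

lemma spectral_decomp_reindex:
  assumes "spectral_decomp n A p e" and \<pi>: "bij_betw \<pi> {..<n} {..<n}"
  shows "spectral_decomp n A (\<lambda>i k. p i (\<pi> k)) (\<lambda>k. e (\<pi> k))"
proof -
  have lt: "\<pi> k < n" if "k < n" for k using \<pi> that by (auto simp: bij_betw_def)
  have inj: "\<pi> k = \<pi> l \<longleftrightarrow> k = l" if "k < n" "l < n" for k l
    using \<pi> that by (auto simp: bij_betw_def inj_on_def)
  have s: "(\<Sum>k<n. f (\<pi> k)) = (\<Sum>k<n. f k)" for f :: "nat \<Rightarrow> real"
    using sum.reindex_bij_betw[OF \<pi>] .
  show ?thesis
    using assms(1) unfolding spectral_decomp_def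
    by (simp add: s[of "\<lambda>k. p _ k * e k * p _ k"] s[of "\<lambda>k. p _ k * p _ k"] lt inj)
qed

lemma spectral_decomp_uminus:
  "spectral_decomp n A p e \<Longrightarrow> spectral_decomp n (\<lambda>i j. - A i j) p (\<lambda>k. - e k)"
  unfolding spectral_decomp_def by (simp add: sum_negf)

text \<open>Parseval's identity in the eigenbasis.\<close>

lemma spectral_decomp_norm:
  assumes "spectral_decomp n A p e"
  shows "(\<Sum>i<n. (x i)\<^sup>2) = (\<Sum>k<n. (\<Sum>i<n. p i k * x i)\<^sup>2)"
proof -
  have "(\<Sum>k<n. (\<Sum>i<n. p i k * x i)\<^sup>2) =
      (\<Sum>k<n. \<Sum>i<n. \<Sum>j<n. x i * x j * (p i k * p j k))"
    by (simp add: power2_eq_square sum_product mult_ac)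
  also have "\<dots> = (\<Sum>i<n. \<Sum>j<n. \<Sum>k<n. x i * x j * (p i k * p j k))"
    by (rule trans[OF sum.swap sum.cong[OF refl sum.swap]])
  also have "\<dots> = (\<Sum>i<n. \<Sum>j<n. x i * x j * (if i = j then 1 else 0))"
    using assms unfolding spectral_decomp_def by (simp flip: sum_distrib_left)
  also have "\<dots> = (\<Sum>i<n. (x i)\<^sup>2)" by (simp add: power2_eq_square if_distrib cong: if_cong)
  finally show ?thesis ..
qed

text \<open>Together with Parseval's identity this makes the Rayleigh quotient of \<open>x\<close> a
  weighted mean of the eigenvalues.\<close>

lemma spectral_decomp_quad:
  assumes "spectral_decomp n A p e"
  shows "(\<Sum>i<n. \<Sum>j<n. x i * A i j * x j) = (\<Sum>k<n. e k * (\<Sum>i<n. p i k * x i)\<^sup>2)"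
proof -
  have "(\<Sum>k<n. e k * (\<Sum>i<n. p i k * x i)\<^sup>2) =
      (\<Sum>k<n. \<Sum>i<n. \<Sum>j<n. x i * (p i k * e k * p j k) * x j)"
    by (simp add: power2_eq_square sum_product sum_distrib_left mult_ac)
  also have "\<dots> = (\<Sum>i<n. \<Sum>j<n. \<Sum>k<n. x i * (p i k * e k * p j k) * x j)"
    by (rule trans[OF sum.swap sum.cong[OF refl sum.swap]])
  also have "\<dots> = (\<Sum>i<n. \<Sum>j<n. x i * A i j * x j)"
    using assms unfolding spectral_decomp_def
    by (simp flip: sum_distrib_left sum_distrib_right)
  finally show ?thesis ..
qed

lemma proots_linear_factors:
  fixes xs :: "'a::idom list"
  shows "proots (\<Prod>a\<leftarrow>xs. [:- a, 1:]) = mset xs"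
proof (induction xs)
  case (Cons a xs)
  have "(\<Prod>a\<leftarrow>xs. [:- a, 1:]) \<noteq> 0" by (auto simp: prod_list_zero_iff)
  then show ?case using Cons by (simp add: proots_mult del: mult_pCons_left)
qed simp

text \<open>Similarity to a diagonal matrix splits the characteristic polynomial into the linear
  factors of the diagonal entries. So \<open>es\<close> is a rearrangement of the diagonal, and
  permuting the columns of the orthogonal matrix in the same way matches them up.\<close>

lemma symmetric_mat_spectral_decomp:
  fixes A :: "real mat"
  assumes A: "A \<in> carrier_mat n n" and sym: "transpose_mat A = A"
  defines "es \<equiv> sorted_list_of_multiset (proots (char_poly A))"
  shows "length es = n \<and> (\<exists>p. spectral_decomp n (\<lambda>i j. A $$ (i, j)) p (\<lambda>k. es ! k))"
proof -
  obtain P where P: "P \<in> carrier_mat n n" and PP: "transpose_mat P * P = 1\<^sub>m n"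
    and diag: "diagonal_mat (transpose_mat P * A * P)"
    using symmetric_mat_diagonalize[OF A sym] by blast
  define D where "D = transpose_mat P * A * P"
  have TP: "transpose_mat P \<in> carrier_mat n n" using P by simp
  have D: "D \<in> carrier_mat n n" unfolding D_def using P A by simp
  have PP': "P * transpose_mat P = 1\<^sub>m n" by (rule mat_mult_left_right_inverse[OF TP P PP])
  have "P * D * transpose_mat P = (P * transpose_mat P) * A * (P * transpose_mat P)"
    unfolding D_def using P A TP by (simp add: assoc_mult_mat[of _ n n _ n _ n])
  then have APD: "A = P * D * transpose_mat P" unfolding PP' using A by simp
  have "similar_mat A D"
    using similar_mat_witI[OF PP' PP APD A D P TP] unfolding similar_mat_def by blast
  then have "char_poly A = char_poly D" by (rule char_poly_similar)
  also have "\<dots> = (\<Prod>a\<leftarrow>diag_mat D. [:- a, 1:])"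
    using diag by (intro char_poly_upper_triangular[OF D])
      (use D in \<open>auto simp: D_def[symmetric] diagonal_mat_def upper_triangular_def\<close>)
  finally have mset: "mset es = mset (diag_mat D)"
    unfolding es_def by (simp add: proots_linear_factors)
  have len: "length (diag_mat D) = n" using D by (simp add: diag_mat_def)
  then have len': "length es = n" using mset by (metis size_mset)
  obtain \<pi> where \<pi>: "\<pi> permutes {..<n}" "permute_list \<pi> (diag_mat D) = es"
    using mset_eq_permutation[OF mset] len by auto
  have es: "es ! k = D $$ (\<pi> k, \<pi> k)" if "k < n" for k
  proof -
    have "\<pi> k < n" using \<pi>(1) that by (meson lessThan_iff permutes_in_image)
    then show ?thesis
      using \<pi> that D len by (auto simp: permute_list_nth diag_mat_def)
  qed
  have "spectral_decomp n (\<lambda>i j. A $$ (i, j)) (\<lambda>i k. P $$ (i, k)) (\<lambda>k. D $$ (k, k))"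
    unfolding spectral_decomp_def
  proof (intro conjI allI impI)
    fix i j assume ij: "i < n" "j < n"
    \<comment> \<open>Multiplying by a diagonal matrix on the right only scales columns.\<close>
    have PD: "(P * D) $$ (i, k) = P $$ (i, k) * D $$ (k, k)" if k: "k < n" for k
    proof -
      have "(P * D) $$ (i, k) = (\<Sum>l = 0..<n. P $$ (i, l) * D $$ (l, k))"
        using ij k P D by (simp add: scalar_prod_def)
      also have "\<dots> = (\<Sum>l = 0..<n. if l = k then P $$ (i, k) * D $$ (k, k) else 0)"
        using diag D k by (intro sum.cong) (auto simp: D_def[symmetric] diagonal_mat_def)
      finally show ?thesis using k by simp
    qed
    have "(X * transpose_mat P) $$ (i, j) = (\<Sum>k = 0..<n. X $$ (i, k) * P $$ (j, k))"
      if "X \<in> carrier_mat n n" for X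
      using ij P that by (simp add: scalar_prod_def)
    from this[of "P * D"] have "A $$ (i, j) = (\<Sum>k = 0..<n. (P * D) $$ (i, k) * P $$ (j, k))"
      unfolding APD[symmetric] using P D by simp
    then show "A $$ (i, j) = (\<Sum>k<n. P $$ (i, k) * D $$ (k, k) * P $$ (j, k))"
      by (simp add: PD atLeast0LessThan)
    have "(P * transpose_mat P) $$ (i, j) = (\<Sum>k<n. P $$ (i, k) * P $$ (j, k))"
      using ij P by (simp add: scalar_prod_def atLeast0LessThan)
    then show "(\<Sum>k<n. P $$ (i, k) * P $$ (j, k)) = (if i = j then 1 else 0)"
      using PP' ij by simp
    have "(transpose_mat P * P) $$ (i, j) = (\<Sum>k<n. P $$ (k, i) * P $$ (k, j))"
      using ij P by (simp add: scalar_prod_def atLeast0LessThan)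
    then show "(\<Sum>k<n. P $$ (k, i) * P $$ (k, j)) = (if i = j then 1 else 0)"
      using PP ij by simp
  qed
  from spectral_decomp_reindex[OF this permutes_imp_bij[OF \<pi>(1)]]
  have "spectral_decomp n (\<lambda>i j. A $$ (i, j)) (\<lambda>i k. P $$ (i, \<pi> k)) (\<lambda>k. es ! k)"
    unfolding spectral_decomp_def by (simp add: es)
  then show ?thesis using len' by blast
qed

section \<open>Cauchy interlacing\<close>

text \<open>There are \<open>i\<close> homogeneous equations in \<open>i + 1\<close> unknowns. A
  zero row added at the bottom makes the matrix square and singular, so its kernel is
  nontrivial.\<close>

lemma underdetermined_system:
  fixes M :: "nat \<Rightarrow> nat \<Rightarrow> real"
  shows "\<exists>c. (\<exists>j\<le>i. c j \<noteq> 0) \<and> (\<forall>l<i. (\<Sum>j\<le>i. M l j * c j) = 0)"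
proof -
  define B where "B = mat (Suc i) (Suc i) (\<lambda>(l, j). if l < i then M l j else 0)"
  have B: "B \<in> carrier_mat (Suc i) (Suc i)" unfolding B_def by simp
  have "B = mat\<^sub>r (Suc i) (Suc i) (\<lambda>l. if l = i then 0\<^sub>v (Suc i) else row B l)"
    by (rule eq_matI) (auto simp: B_def)
  moreover have "det \<dots> = 0" using B by (intro det_row_0) auto
  ultimately have "det B = 0" by simp
  then obtain v where v: "v \<in> carrier_vec (Suc i)" "v \<noteq> 0\<^sub>v (Suc i)" "B *\<^sub>v v = 0\<^sub>v (Suc i)"
    using det_0_iff_vec_prod_zero[OF B] by auto
  obtain j where "j \<le> i" "v $ j \<noteq> 0"
    using v(1,2) by (metis carrier_vecD eq_vecI index_zero_vec less_Suc_eq_le)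
  moreover have "(\<Sum>j\<le>i. M l j * v $ j) = 0" if "l < i" for l
  proof -
    have "(B *\<^sub>v v) $ l = (\<Sum>j<Suc i. M l j * v $ j)"
      using that v(1) by (simp add: B_def scalar_prod_def atLeast0LessThan del: sum.lessThan_Suc)
    then show ?thesis using v(3) that by (simp add: lessThan_Suc_atMost)
  qed
  ultimately show ?thesis by (intro exI[of _ "\<lambda>j. v $ j"]) auto
qed

text \<open>Brings norms and quadratic forms of vectors supported on the image of \<iota> down to
  the smaller index set.\<close>

lemma sum_extend_by_zero:
  fixes f :: "nat \<Rightarrow> 'b::comm_monoid_add"
  assumes "inj_on \<iota> {..<m}" and "\<iota> ` {..<m} \<subseteq> {..<n}"
    and "\<And>i. i < n \<Longrightarrow> i \<notin> \<iota> ` {..<m} \<Longrightarrow> f i = 0"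
  shows "(\<Sum>i<n. f i) = (\<Sum>a<m. f (\<iota> a))"
proof -
  have "(\<Sum>i<n. f i) = sum f (\<iota> ` {..<m})"
    using assms by (intro sum.mono_neutral_right) auto
  also have "\<dots> = (\<Sum>a<m. f (\<iota> a))" using assms(1) by (simp add: sum.reindex)
  finally show ?thesis .
qed

text \<open>
  Among the combinations of the first \<open>i + 1\<close> eigenvectors of \<open>B\<close>, extended by zero, a nonzero
  one is orthogonal to the first \<open>i\<close> eigenvectors of \<open>A\<close>; its Rayleigh quotient lies between
  \<open>e i\<close> and \<open>b i\<close>.
\<close>

lemma principal_submatrix_eigenvalue_ge:
  assumes A: "spectral_decomp n A p e" and B: "spectral_decomp m B q b"
    and inj: "inj_on \<iota> {..<m}" and rng: "\<iota> ` {..<m} \<subseteq> {..<n}"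
    and sub: "\<And>a c. a < m \<Longrightarrow> c < m \<Longrightarrow> B a c = A (\<iota> a) (\<iota> c)"
    and e: "\<And>k l. k \<le> l \<Longrightarrow> l < n \<Longrightarrow> e k \<le> e l"
    and b: "\<And>k l. k \<le> l \<Longrightarrow> l < m \<Longrightarrow> b k \<le> b l"
    and i: "i < m"
  shows "e i \<le> b i"
proof -
  obtain c where c0: "\<exists>j\<le>i. c j \<noteq> 0"
    and c: "\<And>l. l < i \<Longrightarrow> (\<Sum>j\<le>i. (\<Sum>a<m. p (\<iota> a) l * q a j) * c j) = 0"
    using underdetermined_system[of i "\<lambda>l j. \<Sum>a<m. p (\<iota> a) l * q a j"] by metis
  \<comment> \<open>\<open>d\<close> holds the coordinates in the eigenbasis of \<open>B\<close>,
    \<open>y\<close> is the resulting vector, and \<open>x\<close> is its extension by zero along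
    \<iota>.\<close>
  define d where "d j = (if j \<le> i then c j else 0)" for j
  define y where "y a = (\<Sum>j<m. q a j * d j)" for a
  define x where "x t = (if t \<in> \<iota> ` {..<m} then y (the_inv_into {..<m} \<iota> t) else 0)" for t
  have x\<iota>: "x (\<iota> a) = y a" if "a < m" for a
    using that inj by (simp add: x_def the_inv_into_f_f)
  have x0: "x t = 0" if "t \<notin> \<iota> ` {..<m}" for t using that by (simp add: x_def)
  have coord: "(\<Sum>a<m. q a k * y a) = d k" if k: "k < m" for k
  proof -
    have "(\<Sum>a<m. q a k * y a) = (\<Sum>a<m. \<Sum>j<m. d j * (q a k * q a j))"
      unfolding y_def by (simp add: sum_distrib_left mult_ac)
    also have "\<dots> = (\<Sum>j<m. d j * (\<Sum>a<m. q a k * q a j))"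
      by (subst sum.swap) (simp add: sum_distrib_left)
    also have "\<dots> = (\<Sum>j<m. d j * (if k = j then 1 else 0))"
      using B k unfolding spectral_decomp_def by simp
    also have "\<dots> = d k" using k by (simp add: if_distrib cong: if_cong)
    finally show ?thesis .
  qed
  \<comment> \<open>The choice of \<open>c\<close> makes \<open>x\<close> orthogonal to the first
    \<open>i\<close> eigenvectors of \<open>A\<close>.\<close>
  have z: "(\<Sum>t<n. p t l * x t) = 0" if l: "l < i" for l
  proof -
    have "(\<Sum>t<n. p t l * x t) = (\<Sum>a<m. p (\<iota> a) l * x (\<iota> a))"
      using x0 by (intro sum_extend_by_zero[OF inj rng]) simp
    also have "\<dots> = (\<Sum>a<m. \<Sum>j<m. p (\<iota> a) l * q a j * d j)"
      by (simp add: x\<iota> y_def sum_distrib_left mult_ac)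
    also have "\<dots> = (\<Sum>j<m. (\<Sum>a<m. p (\<iota> a) l * q a j) * d j)"
      by (subst sum.swap) (simp add: sum_distrib_right)
    also have "\<dots> = (\<Sum>j\<le>i. (\<Sum>a<m. p (\<iota> a) l * q a j) * d j)"
      using i by (intro sum.mono_neutral_right) (auto simp: d_def)
    also have "\<dots> = 0" using c[OF l] by (simp add: d_def)
    finally show ?thesis .
  qed
  have normx: "(\<Sum>t<n. (x t)\<^sup>2) = (\<Sum>k<m. (d k)\<^sup>2)"
  proof -
    have "(\<Sum>t<n. (x t)\<^sup>2) = (\<Sum>a<m. (x (\<iota> a))\<^sup>2)"
      using x0 by (intro sum_extend_by_zero[OF inj rng]) simp
    then show ?thesis using spectral_decomp_norm[OF B, of y] by (simp add: x\<iota> coord)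
  qed
  have quadx: "(\<Sum>s<n. \<Sum>t<n. x s * A s t * x t) = (\<Sum>k<m. b k * (d k)\<^sup>2)"
  proof -
    have "(\<Sum>s<n. \<Sum>t<n. x s * A s t * x t) = (\<Sum>a<m. \<Sum>t<n. x (\<iota> a) * A (\<iota> a) t * x t)"
      using x0 by (intro sum_extend_by_zero[OF inj rng]) simp
    also have "\<dots> = (\<Sum>a<m. \<Sum>c<m. x (\<iota> a) * A (\<iota> a) (\<iota> c) * x (\<iota> c))"
      using x0 by (intro sum.cong refl sum_extend_by_zero[OF inj rng]) simp
    also have "\<dots> = (\<Sum>a<m. \<Sum>c<m. y a * B a c * y c)" by (simp add: x\<iota> sub)
    finally show ?thesis using spectral_decomp_quad[OF B, of y] by (simp add: coord)
  qed
  have pos: "(\<Sum>k<m. (d k)\<^sup>2) > 0"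
  proof -
    obtain j where "j \<le> i" "c j \<noteq> 0" using c0 by auto
    then show ?thesis using i by (intro sum_pos2[of _ j]) (auto simp: d_def)
  qed
  have rng': "i < n"
  proof -
    have "m \<le> n" using card_inj_on_le[OF inj rng] by simp
    then show ?thesis using i by simp
  qed
  have "e i * (\<Sum>k<m. (d k)\<^sup>2) = (\<Sum>k<n. e i * (\<Sum>t<n. p t k * x t)\<^sup>2)"
    using spectral_decomp_norm[OF A, of x] normx by (simp add: sum_distrib_left)
  \<comment> \<open>The terms with \<open>k < i\<close> vanish by orthogonality; for the others
    \<open>e i \<le> e k\<close>.\<close>
  also have "\<dots> \<le> (\<Sum>k<n. e k * (\<Sum>t<n. p t k * x t)\<^sup>2)"
  proof (rule sum_mono)
    fix k assume "k \<in> {..<n}"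
    then show "e i * (\<Sum>t<n. p t k * x t)\<^sup>2 \<le> e k * (\<Sum>t<n. p t k * x t)\<^sup>2"
      using z[of k] e[of i k] by (cases "k < i") (auto intro: mult_right_mono)
  qed
  also have "\<dots> = (\<Sum>k<m. b k * (d k)\<^sup>2)"
    using spectral_decomp_quad[OF A, of x] quadx by simp
  \<comment> \<open>Here \<open>d k = 0\<close> beyond \<open>i\<close>, and
    \<open>b k \<le> b i\<close> up to \<open>i\<close>.\<close>
  also have "\<dots> \<le> (\<Sum>k<m. b i * (d k)\<^sup>2)"
  proof (rule sum_mono)
    fix k assume "k \<in> {..<m}"
    then show "b k * (d k)\<^sup>2 \<le> b i * (d k)\<^sup>2"
      using b[of k i] i by (cases "k \<le> i") (auto simp: d_def intro: mult_right_mono)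
  qed
  also have "\<dots> = b i * (\<Sum>k<m. (d k)\<^sup>2)" by (simp add: sum_distrib_left)
  finally show ?thesis using pos by simp
qed

text \<open>The previous bound for the negated matrices. Negation reverses the order of the
  eigenvalues, so positions are counted from the top: \<open>i\<close> becomes
  \<open>m - Suc i\<close> in \<open>B\<close>, and this position from the top in \<open>A\<close>
  is \<open>i + (n - m)\<close>.\<close>

lemma principal_submatrix_eigenvalue_le:
  assumes A: "spectral_decomp n A p e" and B: "spectral_decomp m B q b"
    and inj: "inj_on \<iota> {..<m}" and rng: "\<iota> ` {..<m} \<subseteq> {..<n}"
    and sub: "\<And>a c. a < m \<Longrightarrow> c < m \<Longrightarrow> B a c = A (\<iota> a) (\<iota> c)"
    and e: "\<And>k l. k \<le> l \<Longrightarrow> l < n \<Longrightarrow> e k \<le> e l"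
    and b: "\<And>k l. k \<le> l \<Longrightarrow> l < m \<Longrightarrow> b k \<le> b l"
    and i: "i < m"
  shows "b i \<le> e (i + (n - m))"
proof -
  have "m \<le> n" using card_inj_on_le[OF inj rng] by simp
  have bij: "bij_betw (\<lambda>k. N - Suc k) {..<N} {..<N}" for N
    by (rule bij_betwI[of _ _ _ "\<lambda>k. N - Suc k"]) auto
  have "- e (n - Suc (m - Suc i)) \<le> - b (m - Suc (m - Suc i))"
    by (rule principal_submatrix_eigenvalue_ge[where e = "\<lambda>k. - e (n - Suc k)"
          and b = "\<lambda>k. - b (m - Suc k)",
        OF spectral_decomp_reindex[OF spectral_decomp_uminus[OF A] bij]
          spectral_decomp_reindex[OF spectral_decomp_uminus[OF B] bij] inj rng])
      (use i in \<open>auto simp: sub intro: e b\<close>)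
  moreover have "n - Suc (m - Suc i) = i + (n - m)" "m - Suc (m - Suc i) = i"
    using i \<open>m \<le> n\<close> by auto
  ultimately show ?thesis by simp
qed

section \<open>Spectra of graphs\<close>

lemma adjacent_commute: "adjacent G x y \<longleftrightarrow> adjacent G y x"
  unfolding adjacent_def by (simp add: insert_commute)

lemma vertex_list:
  assumes "finite (verts G)"
  shows "distinct (vertex_list G)" and "set (vertex_list G) = verts G"
    and "length (vertex_list G) = card (verts G)"
proof -
  have "\<exists>xs. distinct xs \<and> set xs = verts G" using finite_distinct_list[OF assms] by blast
  then have "distinct (vertex_list G) \<and> set (vertex_list G) = verts G"
    unfolding vertex_list_def by (rule someI_ex)
  then show "distinct (vertex_list G)" "set (vertex_list G) = verts G" by auto
  then show "length (vertex_list G) = card (verts G)" using distinct_card by fastforce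
qed

lemma bij_betw_vertex_list:
  "finite (verts G) \<Longrightarrow> bij_betw (\<lambda>i. vertex_list G ! i) {..<card (verts G)} (verts G)"
  by (rule bij_betw_nth) (simp_all add: vertex_list)

lemma adj_matrix_carrier: "adj_matrix G \<in> carrier_mat (card (verts G)) (card (verts G))"
  unfolding adj_matrix_def by simp

lemma transpose_adj_matrix: "transpose_mat (adj_matrix G) = adj_matrix G"
  by (rule eq_matI) (auto simp: adj_matrix_def adjacent_commute)

lemma graph_eigenvalues_spectral_decomp:
  "length (graph_eigenvalues G) = card (verts G) \<and>
    (\<exists>p. spectral_decomp (card (verts G)) (\<lambda>i j. adj_matrix G $$ (i, j)) p (\<lambda>k. graph_eigenvalues G ! k))"
  unfolding graph_eigenvalues_def
  by (rule symmetric_mat_spectral_decomp[OF adj_matrix_carrier transpose_adj_matrix])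

text \<open>The adjacency matrix of an induced subgraph is a principal submatrix, up to the
  enumeration of vertices, so the two bounds above apply. Properness of the inclusion gives the
  strict inequality of lengths in \<open>interlaces\<close>.\<close>

lemma induced_subgraph_interlaces:
  assumes fin: "finite (verts G)" and inj: "inj_on \<phi> (verts H)"
    and sub: "\<phi> ` verts H \<subset> verts G"
    and adj: "\<And>x y. x \<in> verts H \<Longrightarrow> y \<in> verts H \<Longrightarrow>
      adjacent H x y \<longleftrightarrow> adjacent G (\<phi> x) (\<phi> y)"
  shows "interlaces (graph_eigenvalues H) (graph_eigenvalues G)"
proof -
  let ?n = "card (verts G)" and ?m = "card (verts H)"
  have finH: "finite (verts H)" using sub fin inj by (meson finite_imageD finite_subset psubset_imp_subset)
  have less: "?m < ?n" using psubset_card_mono[OF fin sub] card_image[OF inj] by simp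
  let ?vG = "\<lambda>i. vertex_list G ! i" and ?vH = "\<lambda>i. vertex_list H ! i"
  note bG = bij_betw_vertex_list[OF fin] and bH = bij_betw_vertex_list[OF finH]
  \<comment> \<open>\<iota> sends a position in the enumeration of \<open>H\<close> to the position
    of its image vertex in the enumeration of \<open>G\<close>.\<close>
  define \<iota> where "\<iota> a = the_inv_into {..<?n} ?vG (\<phi> (?vH a))" for a
  have vH: "?vH a \<in> verts H" if "a < ?m" for a using bH that by (auto simp: bij_betw_def)
  have \<phi>vH: "\<phi> (?vH a) \<in> verts G" if "a < ?m" for a using vH[OF that] sub by auto
  have \<iota>: "\<iota> a < ?n" "?vG (\<iota> a) = \<phi> (?vH a)" if "a < ?m" for a
  proof -
    have "\<iota> a \<in> {..<?n}" unfolding \<iota>_def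
      using bG \<phi>vH[OF that] by (intro the_inv_into_into) (auto simp: bij_betw_def)
    then show "\<iota> a < ?n" by simp
    show "?vG (\<iota> a) = \<phi> (?vH a)" unfolding \<iota>_def
      using f_the_inv_into_f_bij_betw[OF bG] \<phi>vH[OF that] by simp
  qed
  have inj\<iota>: "inj_on \<iota> {..<?m}"
  proof (rule inj_onI)
    fix a c assume "a \<in> {..<?m}" "c \<in> {..<?m}" "\<iota> a = \<iota> c"
    then have "?vH a = ?vH c" using \<iota> inj vH by (metis inj_onD lessThan_iff)
    then show "a = c" using bH \<open>a \<in> {..<?m}\<close> \<open>c \<in> {..<?m}\<close> by (auto simp: bij_betw_def inj_on_def)
  qed
  have rng: "\<iota> ` {..<?m} \<subseteq> {..<?n}" using \<iota>(1) by auto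
  have entries: "adj_matrix H $$ (a, c) = adj_matrix G $$ (\<iota> a, \<iota> c)" if "a < ?m" "c < ?m" for a c
    using that \<iota> vH adj by (simp add: adj_matrix_def)
  let ?e = "graph_eigenvalues G" and ?b = "graph_eigenvalues H"
  obtain p where G: "spectral_decomp ?n (\<lambda>i j. adj_matrix G $$ (i, j)) p (\<lambda>k. ?e ! k)"
    and le: "length ?e = ?n" using graph_eigenvalues_spectral_decomp by blast
  obtain q where H: "spectral_decomp ?m (\<lambda>i j. adj_matrix H $$ (i, j)) q (\<lambda>k. ?b ! k)"
    and lb: "length ?b = ?m" using graph_eigenvalues_spectral_decomp by blast
  have se: "sorted ?e" and sb: "sorted ?b" unfolding graph_eigenvalues_def by simp_all
  note mono = sorted_nth_mono[OF se, unfolded le] sorted_nth_mono[OF sb, unfolded lb]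
  show ?thesis
    unfolding interlaces_def le lb
    using principal_submatrix_eigenvalue_ge[OF G H inj\<iota> rng entries mono]
      principal_submatrix_eigenvalue_le[OF G H inj\<iota> rng entries mono] se sb less
    by blast
qed

text \<open>Read the eigenvalue equation at a coordinate of largest absolute value: that row has at
  most \<open>d\<close> ones, and each contributes at most this maximum.\<close>

lemma adj_matrix_eigenvalue_bound:
  assumes fin: "finite (verts G)" and deg: "\<And>x. x \<in> verts G \<Longrightarrow> card (neighbours G x) \<le> d"
    and ev: "eigenvalue (adj_matrix G) \<theta>"
  shows "\<bar>\<theta>\<bar> \<le> d"
proof -
  let ?n = "card (verts G)" and ?A = "adj_matrix G" and ?v = "\<lambda>i. vertex_list G ! i"
  note A = adj_matrix_carrier[of G] and bij = bij_betw_vertex_list[OF fin]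
  obtain x where x: "x \<in> carrier_vec ?n" "x \<noteq> 0\<^sub>v ?n" "?A *\<^sub>v x = \<theta> \<cdot>\<^sub>v x"
    using ev A unfolding eigenvalue_def eigenvector_def by auto
  obtain j where j: "j < ?n" "x $ j \<noteq> 0" using x(1,2) by (metis carrier_vecD eq_vecI index_zero_vec)
  obtain i where i: "i < ?n" and max: "\<And>l. l < ?n \<Longrightarrow> \<bar>x $ l\<bar> \<le> \<bar>x $ i\<bar>"
  proof -
    let ?M = "(\<lambda>l. \<bar>x $ l\<bar>) ` {..<?n}"
    have "Max ?M \<in> ?M" using j by (intro Max_in) auto
    then obtain i where "i < ?n" "\<bar>x $ i\<bar> = Max ?M" by auto
    then show ?thesis using that[of i] by simp
  qed
  have pos: "\<bar>x $ i\<bar> > 0" using max[OF j(1)] j(2) by simp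
  have "\<bar>\<theta>\<bar> * \<bar>x $ i\<bar> = \<bar>(?A *\<^sub>v x) $ i\<bar>" using x i by (simp add: abs_mult)
  also have "(?A *\<^sub>v x) $ i = (\<Sum>l<?n. ?A $$ (i, l) * x $ l)"
    using x(1) i A by (simp add: scalar_prod_def atLeast0LessThan)
  also have "\<bar>\<dots>\<bar> \<le> (\<Sum>l<?n. ?A $$ (i, l) * \<bar>x $ i\<bar>)"
    using i max by (intro order.trans[OF sum_abs] sum_mono) (auto simp: abs_mult adj_matrix_def)
  also have "\<dots> = (\<Sum>l<?n. ?A $$ (i, l)) * \<bar>x $ i\<bar>" by (simp add: sum_distrib_right)
  also have "(\<Sum>l<?n. ?A $$ (i, l)) = (\<Sum>l<?n. if adjacent G (?v i) (?v l) then 1 else 0)"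
    using i by (simp add: adj_matrix_def)
  also have "\<dots> = (\<Sum>y\<in>verts G. if adjacent G (?v i) y then 1 else 0)"
    by (rule sum.reindex_bij_betw[OF bij])
  also have "\<dots> = card (neighbours G (?v i))"
    using fin by (simp add: neighbours_def flip: sum.inter_filter)
  also have "real (card (neighbours G (?v i))) * \<bar>x $ i\<bar> \<le> d * \<bar>x $ i\<bar>"
    using deg[of "?v i"] i bij by (intro mult_right_mono) (auto simp: bij_betw_def)
  finally show ?thesis using pos by simp
qed

section \<open>Anti-Gallai graphs and wheels\<close>

lemma simple_graphD:
  assumes "simple_graph G" "adjacent G x y"
  shows "x \<in> verts G" "y \<in> verts G" "x \<noteq> y"
  using assms unfolding simple_graph_def adjacent_def by (force simp: card_insert_if split: if_splits)+

lemma simple_graph_edgeE: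
  assumes "simple_graph G" "e \<in> edges G"
  obtains x y where "e = {x, y}" "x \<noteq> y" "adjacent G x y" "x \<in> verts G" "y \<in> verts G"
proof -
  have "card e = 2" using assms unfolding simple_graph_def by auto
  then obtain x y where "e = {x, y}" "x \<noteq> y" by (meson card_2_iff)
  then show thesis using that assms simple_graphD[of G x y] by (simp add: adjacent_def)
qed

lemma adjacent_anti_gallai:
  "adjacent (anti_gallai G) e f \<longleftrightarrow> e \<in> edges G \<and> f \<in> edges G \<and> e \<noteq> f \<and>
     (\<exists>T\<in>triangles G. e \<subseteq> T \<and> f \<subseteq> T)" (is "?l \<longleftrightarrow> ?r")
proof
  assume ?l
  then obtain a b where "{e, f} = {a, b}" "a \<in> edges G" "b \<in> edges G" "a \<noteq> b"
      "\<exists>T\<in>triangles G. a \<subseteq> T \<and> b \<subseteq> T"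
    unfolding adjacent_def anti_gallai_def by auto
  then show ?r by (auto simp: doubleton_eq_iff)
next
  assume ?r
  then show ?l unfolding adjacent_def anti_gallai_def ugraph.simps by blast
qed

lemma triangle_through_edge:
  assumes "T \<in> triangles G" "x \<in> T" "y \<in> T" "x \<noteq> y"
  obtains z where "T = {x, y, z}" "z \<in> neighbours G x \<inter> neighbours G y"
proof -
  have T: "card T = 3" "T \<subseteq> verts G" and adj: "\<And>a b. a \<in> T \<Longrightarrow> b \<in> T \<Longrightarrow> a \<noteq> b \<Longrightarrow> adjacent G a b"
    using assms(1) unfolding triangles_def by auto
  have "card (T - {x, y}) = 1" using T(1) assms(2-4) by (subst card_Diff_subset) auto
  then obtain z where z: "T - {x, y} = {z}" by (auto simp: card_1_singleton_iff)
  then have "T = {x, y, z}" "z \<in> T" "z \<noteq> x" "z \<noteq> y" using assms(2,3) by auto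
  then show thesis using that assms(2,3) adj T(2) by (auto simp: neighbours_def)
qed

lemma triangleI:
  assumes "simple_graph G" "adjacent G x y" "adjacent G y z" "adjacent G x z"
  shows "{x, y, z} \<in> triangles G"
  using assms simple_graphD[OF assms(1)] adjacent_commute[of G]
  unfolding triangles_def by (auto simp: card_insert_if)

text \<open>A triangle on the edge \<open>{x, y}\<close> is determined by a common neighbour
  \<open>z\<close> and provides just the two further edges \<open>{x, z}\<close> and
  \<open>{y, z}\<close>.\<close>

lemma anti_gallai_degree_le:
  assumes "strongly_regular G n k l m" and e: "e \<in> edges G"
  shows "card (neighbours (anti_gallai G) e) \<le> 2 * l"
proof -
  have simple: "simple_graph G" using assms(1) unfolding strongly_regular_def by simp
  obtain x y where xy: "e = {x, y}" "x \<noteq> y" "adjacent G x y" "x \<in> verts G" "y \<in> verts G"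
    using simple_graph_edgeE[OF simple e] .
  let ?C = "neighbours G x \<inter> neighbours G y"
  have fin: "finite ?C" using simple unfolding simple_graph_def neighbours_def by simp
  have "neighbours (anti_gallai G) e \<subseteq> (\<lambda>(a, b). {a, b}) ` ({x, y} \<times> ?C)"
  proof
    fix f assume "f \<in> neighbours (anti_gallai G) e"
    then have f: "f \<in> edges G" "e \<noteq> f" "\<exists>T\<in>triangles G. e \<subseteq> T \<and> f \<subseteq> T"
      unfolding neighbours_def adjacent_anti_gallai by auto
    then obtain T where T: "T \<in> triangles G" "e \<subseteq> T" "f \<subseteq> T" by auto
    obtain z where z: "T = {x, y, z}" "z \<in> ?C"
      using triangle_through_edge[OF T(1), of x y] T(2) xy by auto
    obtain a b where "f = {a, b}" "a \<noteq> b" using simple_graph_edgeE[OF simple f(1)] .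
    then have "f = {x, z} \<or> f = {y, z}" using T(3) f(2) z(1) xy(1) by auto
    then show "f \<in> (\<lambda>(a, b). {a, b}) ` ({x, y} \<times> ?C)" using z(2) by auto
  qed
  then have "card (neighbours (anti_gallai G) e) \<le> card ((\<lambda>(a, b). {a, b}) ` ({x, y} \<times> ?C))"
    using fin by (intro card_mono) auto
  also have "\<dots> \<le> card ({x, y} \<times> ?C)" using fin by (intro card_image_le) auto
  also have "\<dots> = 2 * l"
    using assms(1) xy unfolding strongly_regular_def by (simp add: card_cartesian_product)
  finally show ?thesis .
qed

section \<open>Wheels, their rims, and neighbourhoods that are single cycles\<close>

lemma cycle_graph_adjacent:
  "adjacent (cycle_graph m) i j \<longleftrightarrow> i < m \<and> j < m \<and> (j = Suc i mod m \<or> i = Suc j mod m)"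
  unfolding adjacent_def cycle_graph_def by (auto simp: doubleton_eq_iff)

text \<open>A wheel given by a cyclic enumeration of its rim. Chords between rim vertices are
  allowed, since wheels need not be induced.\<close>

definition rim_of_wheel :: "'a ugraph \<Rightarrow> 'a \<Rightarrow> nat \<Rightarrow> (nat \<Rightarrow> 'a) \<Rightarrow> bool" where
  "rim_of_wheel G u m g \<longleftrightarrow> m \<ge> 3 \<and> inj_on g {..<m} \<and> g ` {..<m} \<subseteq> neighbours G u \<and>
     (\<forall>i<m. adjacent G (g i) (g (Suc i mod m)))"

text \<open>The vertex set of \<open>H\<close> is kept because it is what later tells two wheels
  apart.\<close>

lemma wheel_inD:
  assumes "wheel_in G u H"
  shows "\<exists>m g. rim_of_wheel G u m g \<and> verts H = insert u (g ` {..<m})"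
proof -
  obtain m f where m: "m \<ge> 3" and iso: "graph_iso f (wheel_graph m) H" and u: "f None = u"
    and sub: "subgraph H G" using assms unfolding wheel_in_def by auto
  let ?V = "insert None (Some ` {..<m})"
  have V: "verts (wheel_graph m) = ?V" by (simp add: wheel_graph_def cycle_graph_def)
  have bij: "bij_betw f ?V (verts H)" using iso unfolding graph_iso_def V by simp
  have adj: "adjacent G (f x) (f y)" if "x \<in> ?V" "y \<in> ?V" "{x, y} \<in> edges (wheel_graph m)" for x y
    using that iso sub unfolding graph_iso_def V subgraph_def adjacent_def by auto
  define g where "g i = f (Some i)" for i
  have "rim_of_wheel G u m g"
    unfolding rim_of_wheel_def
  proof (intro conjI allI impI m)
    show "inj_on g {..<m}" using bij unfolding bij_betw_def inj_on_def g_def by auto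
    show "g ` {..<m} \<subseteq> neighbours G u"
    proof
      fix x assume "x \<in> g ` {..<m}"
      then obtain i where i: "i < m" "x = f (Some i)" by (auto simp: g_def)
      have "x \<in> verts H" using bij i by (auto simp: bij_betw_def)
      then have "x \<in> verts G" using sub unfolding subgraph_def by auto
      moreover have "adjacent G (f None) (f (Some i))"
        using i by (intro adj) (auto simp: wheel_graph_def cycle_graph_def)
      ultimately show "x \<in> neighbours G u" using i u by (simp add: neighbours_def)
    qed
    fix i assume i: "i < m"
    have "{i, Suc i mod m} \<in> edges (cycle_graph m)"
      using i by (auto simp: cycle_graph_def)
    then have "Some ` {i, Suc i mod m} \<in> edges (wheel_graph m)"
      unfolding wheel_graph_def by (simp del: image_insert)
    then have "{Some i, Some (Suc i mod m)} \<in> edges (wheel_graph m)" by simp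
    then show "adjacent G (g i) (g (Suc i mod m))" unfolding g_def using i m by (intro adj) auto
  qed
  moreover have "verts H = insert u (g ` {..<m})"
    using bij u by (auto simp: bij_betw_def g_def)
  ultimately show ?thesis by blast
qed

lemma wheel_edge_subset:
  assumes "e \<in> edges (wheel_graph m)"
  shows "e \<subseteq> insert None (Some ` {..<m})"
proof -
  have "Suc i mod m < m" if "i < m" for i using that by (intro mod_less_divisor) simp
  then show ?thesis using assms by (auto simp: wheel_graph_def cycle_graph_def)
qed

lemma wheel_inI:
  assumes simple: "simple_graph G" and rim: "rim_of_wheel G u m g"
  shows "\<exists>H. wheel_in G u H \<and> verts H = insert u (g ` {..<m})"
proof -
  have m: "m \<ge> 3" and inj: "inj_on g {..<m}" and N: "g ` {..<m} \<subseteq> neighbours G u"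
    and adj: "\<And>i. i < m \<Longrightarrow> adjacent G (g i) (g (Suc i mod m))"
    using rim unfolding rim_of_wheel_def by auto
  define f where "f = case_option u g"
  let ?V = "insert None (Some ` {..<m})"
  have V: "verts (wheel_graph m) = ?V" by (simp add: wheel_graph_def cycle_graph_def)
  have u: "u \<notin> g ` {..<m}" using N simple_graphD(3)[OF simple, of u u] by (auto simp: neighbours_def)
  have injf: "inj_on f ?V" using inj u by (auto simp: inj_on_def f_def split: option.splits)
  \<comment> \<open>Only images of wheel edges are taken, not all edges that \<open>G\<close>
    induces, so that \<open>f\<close> reflects adjacency even when the rim has chords.\<close>
  define H where "H = \<lparr>verts = insert u (g ` {..<m}), edges = (`) f ` edges (wheel_graph m)\<rparr>"
  have fV: "f ` ?V = verts H" by (simp add: H_def f_def image_image)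
  have uV: "u \<in> verts G"
  proof -
    have "g 0 \<in> neighbours G u" using N m by auto
    then show ?thesis using simple_graphD(1)[OF simple] by (auto simp: neighbours_def)
  qed
  have E: "edges H \<subseteq> edges G"
  proof
    fix e assume "e \<in> edges H"
    then obtain d where d: "d \<in> edges (wheel_graph m)" "e = f ` d" by (auto simp: H_def)
    then consider i where "i < m" "d = {Some i, Some (Suc i mod m)}" | i where "i < m" "d = {None, Some i}"
      by (auto simp: wheel_graph_def cycle_graph_def)
    then show "e \<in> edges G"
    proof cases
      case 1
      then show ?thesis using adj d by (simp add: f_def adjacent_def)
    next
      case 2
      then have "g i \<in> neighbours G u" using N by auto
      then show ?thesis using 2 d by (simp add: f_def adjacent_def neighbours_def)
    qed
  qed
  have "\<forall>e\<in>edges H. e \<subseteq> verts H"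
    using wheel_edge_subset fV by (fastforce simp: H_def)
  then have "subgraph H G"
    using simple E N uV unfolding subgraph_def simple_graph_def
    by (auto simp: H_def neighbours_def)
  moreover have "graph_iso f (wheel_graph m) H"
    unfolding graph_iso_def
  proof (intro conjI ballI)
    show "bij_betw f (verts (wheel_graph m)) (verts H)"
      unfolding V using injf fV by (simp add: bij_betw_def)
    fix x y assume "x \<in> verts (wheel_graph m)" "y \<in> verts (wheel_graph m)"
    then have xy: "{x, y} \<subseteq> ?V" by (simp add: V)
    show "adjacent (wheel_graph m) x y \<longleftrightarrow> adjacent H (f x) (f y)"
    proof
      assume "adjacent (wheel_graph m) x y"
      then have "f ` {x, y} \<in> edges H" unfolding adjacent_def H_def by (simp del: image_insert)
      then show "adjacent H (f x) (f y)" by (simp add: adjacent_def)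
    next
      assume "adjacent H (f x) (f y)"
      then obtain d where "d \<in> edges (wheel_graph m)" "f ` {x, y} = f ` d"
        by (auto simp: adjacent_def H_def)
      then show "adjacent (wheel_graph m) x y"
        using inj_on_image_eq_iff[OF injf xy wheel_edge_subset] by (auto simp: adjacent_def)
    qed
  qed
  moreover have "f None = u" by (simp add: f_def)
  ultimately have "wheel_in G u H" unfolding wheel_in_def using m by blast
  then show ?thesis by (auto simp: H_def)
qed

text \<open>Successor and predecessor on the rim already account for the two neighbours that a rim
  vertex has inside the neighbourhood of \<open>u\<close>. So the rim has no chords and no edges to
  the rest of the neighbourhood.\<close>

lemma rim_neighbour:
  assumes simple: "simple_graph G" and rim: "rim_of_wheel G u m g"
    and two: "\<And>x. x \<in> neighbours G u \<Longrightarrow> card (neighbours G u \<inter> neighbours G x) = 2"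
    and i: "i < m" and y: "y \<in> neighbours G u" "adjacent G (g i) y"
  shows "\<exists>j<m. y = g j \<and> (j = Suc i mod m \<or> i = Suc j mod m)"
proof -
  have m: "m \<ge> 3" and inj: "inj_on g {..<m}" and N: "g ` {..<m} \<subseteq> neighbours G u"
    and adj: "\<And>i. i < m \<Longrightarrow> adjacent G (g i) (g (Suc i mod m))"
    using rim unfolding rim_of_wheel_def by auto
  \<comment> \<open>\<open>?p\<close> is the cyclic predecessor, which wraps around at 0; it differs
    from the successor \<open>?s\<close> because \<open>m \<ge> 3\<close>.\<close>
  let ?s = "Suc i mod m" and ?p = "if i = 0 then m - 1 else i - 1"
  have p: "?p < m" "Suc ?p mod m = i" using i m by auto
  have s: "?s < m" using m by simp
  have sp: "?s \<noteq> ?p" using i m by (cases "Suc i = m") auto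
  have fin: "finite (neighbours G u \<inter> neighbours G (g i))"
    using simple unfolding simple_graph_def neighbours_def by simp
  have "g ?s \<in> neighbours G u" "g ?p \<in> neighbours G u" using N s p(1) by blast+
  then have "{g ?s, g ?p} \<subseteq> neighbours G u \<inter> neighbours G (g i)"
    using adj[OF i] adj[OF p(1)] p(2)
    by (simp add: neighbours_def adjacent_commute[of G "g i"])
  moreover have "card {g ?s, g ?p} = 2"
    using sp inj p(1) s by (auto simp: inj_on_def card_insert_if)
  ultimately have "{g ?s, g ?p} = neighbours G u \<inter> neighbours G (g i)"
    using two[of "g i"] N i fin by (intro card_subset_eq) auto
  moreover have "y \<in> neighbours G u \<inter> neighbours G (g i)" using y by (auto simp: neighbours_def)
  ultimately have "y = g ?s \<or> y = g ?p" by blast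
  then show ?thesis using p s by metis
qed

text \<open>A non-backtracking walk in a finite graph must close up; its shortest closed segment is a cycle.\<close>

lemma cycle_exists:
  assumes simple: "simple_graph G" and S: "finite S" "S \<noteq> {}"
    and deg: "\<And>a b. a \<in> S \<Longrightarrow> \<exists>c\<in>S. adjacent G a c \<and> c \<noteq> b"
  shows "\<exists>m\<ge>3. \<exists>g. inj_on g {..<m} \<and> g ` {..<m} \<subseteq> S \<and>
    (\<forall>i<m. adjacent G (g i) (g (Suc i mod m)))"
proof -
  \<comment> \<open>The state of the walk is a directed edge (previous vertex, current vertex), so
    that dependent choice can forbid stepping straight back.\<close>
  have "\<exists>P. \<forall>n. (fst (P n) \<in> S \<and> snd (P n) \<in> S \<and> adjacent G (fst (P n)) (snd (P n))) \<and>
      (fst (P (Suc n)) = snd (P n) \<and> snd (P (Suc n)) \<noteq> fst (P n))"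
  proof (rule dependent_nat_choice)
    show "\<exists>x. fst x \<in> S \<and> snd x \<in> S \<and> adjacent G (fst x) (snd x)"
      using S(2) deg by fastforce
    show "\<exists>y. (fst y \<in> S \<and> snd y \<in> S \<and> adjacent G (fst y) (snd y)) \<and>
        fst y = snd x \<and> snd y \<noteq> fst x"
      if "fst x \<in> S \<and> snd x \<in> S \<and> adjacent G (fst x) (snd x)" for x and n :: nat
      using that deg[of "snd x" "fst x"] by (metis fst_conv snd_conv)
  qed
  then obtain P where P: "\<And>n. fst (P n) \<in> S" "\<And>n. adjacent G (fst (P n)) (snd (P n))"
    "\<And>n. fst (P (Suc n)) = snd (P n)" "\<And>n. snd (P (Suc n)) \<noteq> fst (P n)" by blast
  define w where "w n = fst (P n)" for n
  have wS: "w n \<in> S" and wadj: "adjacent G (w n) (w (Suc n))" and w2: "w (Suc (Suc n)) \<noteq> w n" for n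
    using P by (simp_all add: w_def)
  have w1: "w (Suc n) \<noteq> w n" for n using simple_graphD(3)[OF simple wadj] by metis
  \<comment> \<open>\<open>Q d\<close> says that the walk returns to some vertex after
    \<open>d > 0\<close> steps. The pigeonhole principle provides such a \<open>d\<close>.\<close>
  define Q where "Q d \<longleftrightarrow> d > 0 \<and> (\<exists>i. w (i + d) = w i)" for d
  have "\<not> inj w" using S(1) wS by (meson finite_subset image_subsetI infinite_UNIV_nat finite_imageD)
  then obtain a b where "w a = w b" "a \<noteq> b" unfolding inj_def by blast
  then have "\<exists>d. Q d"
  proof (induction a b rule: linorder_wlog)
    case (le a b)
    then show ?case by (intro exI[of _ "b - a"]) (auto simp: Q_def intro!: exI[of _ a])
  next
    case (sym a b)
    then show ?case by metis
  qed
  define d where "d = (LEAST d. Q d)"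
  have "Q d" unfolding d_def using \<open>\<exists>d. Q d\<close> by (rule LeastI_ex)
  then obtain i where d0: "d > 0" and i: "w (i + d) = w i" unfolding Q_def by blast
  have least: "\<not> Q c" if "c < d" for c using that unfolding d_def by (rule not_less_Least)
  \<comment> \<open>Length 1 would be a loop, and length 2 a step straight back.\<close>
  have "d \<noteq> 1" "d \<noteq> 2" using i w1[of i] w2[of i] by (auto simp: numeral_2_eq_2)
  then have d3: "d \<ge> 3" using d0 by auto
  \<comment> \<open>A repetition strictly inside the segment would be a shorter return.\<close>
  have ne: "w (i + s) \<noteq> w (i + t)" if "s < t" "t < d" for s t
  proof
    assume "w (i + s) = w (i + t)"
    then have "Q (t - s)"
      using that unfolding Q_def by (intro conjI exI[of _ "i + s"]) simp_all
    then show False using least[of "t - s"] that by auto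
  qed
  have "inj_on (\<lambda>t. w (i + t)) {..<d}"
    by (rule inj_onI) (metis ne lessThan_iff nat_neq_iff)
  moreover have "adjacent G (w (i + t)) (w (i + Suc t mod d))" if "t < d" for t
    using that wadj[of "i + t"] i by (cases "Suc t = d") auto
  ultimately show ?thesis
    using d3 wS by (intro exI[of _ d] conjI exI[of _ "\<lambda>t. w (i + t)"]) auto
qed

text \<open>If the rim missed some neighbours of \<open>u\<close>, these would have both their
  neighbours within the neighbourhood among themselves, hence contain a cycle. That cycle would be
  the rim of a second wheel at \<open>u\<close>.\<close>

lemma unique_wheel_rim:
  assumes simple: "simple_graph G" and u: "u \<in> verts G"
    and two: "\<And>x. x \<in> neighbours G u \<Longrightarrow> card (neighbours G u \<inter> neighbours G x) = 2"
    and unique: "\<exists>!H. wheel_in G u H"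
  obtains g where "rim_of_wheel G u (card (neighbours G u)) g"
    and "g ` {..<card (neighbours G u)} = neighbours G u"
proof -
  obtain H where H: "wheel_in G u H" using unique by auto
  obtain m g where rim: "rim_of_wheel G u m g" and vH: "verts H = insert u (g ` {..<m})"
    using wheel_inD[OF H] by blast
  let ?R = "g ` {..<m}" and ?N = "neighbours G u"
  have N: "?R \<subseteq> ?N" using rim unfolding rim_of_wheel_def by auto
  have finN: "finite ?N" using simple unfolding simple_graph_def neighbours_def by simp
  have "?R = ?N"
  proof (rule ccontr)
    assume "?R \<noteq> ?N"
    define S where "S = ?N - ?R"
    have S: "finite S" "S \<noteq> {}" using \<open>?R \<noteq> ?N\<close> N finN unfolding S_def by auto
    \<comment> \<open>A rim vertex adjacent to \<open>a\<close> would put \<open>a\<close> on the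
      rim by \<open>rim_neighbour\<close>. So both neighbours of \<open>a\<close> inside
      \<open>?N\<close> lie in \<open>S\<close>, and one of them differs from
      \<open>b\<close>.\<close>
    have deg: "\<exists>c\<in>S. adjacent G a c \<and> c \<noteq> b" if a: "a \<in> S" for a b
    proof -
      have "card (?N \<inter> neighbours G a) = 2" using two a unfolding S_def by auto
      then obtain c c' where c: "?N \<inter> neighbours G a = {c, c'}" "c \<noteq> c'" by (meson card_2_iff)
      have "z \<in> S \<and> adjacent G a z" if "z \<in> ?N \<inter> neighbours G a" for z
      proof -
        have "z \<notin> ?R"
        proof
          assume "z \<in> ?R"
          then obtain i where "i < m" "z = g i" by auto
          then have "a \<in> ?R"
            using rim_neighbour[OF simple rim two, of i a] that a
            by (auto simp: S_def neighbours_def adjacent_commute)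
          then show False using a by (simp add: S_def)
        qed
        then show ?thesis using that by (auto simp: S_def neighbours_def)
      qed
      then show ?thesis using c by (metis insertI1 insertI2)
    qed
    obtain m' g' where g': "m' \<ge> 3" "inj_on g' {..<m'}" "g' ` {..<m'} \<subseteq> S"
      "\<forall>i<m'. adjacent G (g' i) (g' (Suc i mod m'))"
      using cycle_exists[OF simple S deg] by blast
    then have "rim_of_wheel G u m' g'" unfolding rim_of_wheel_def S_def by blast
    then obtain H' where H': "wheel_in G u H'" "verts H' = insert u (g' ` {..<m'})"
      using wheel_inI[OF simple] by blast
    \<comment> \<open>This vertex lies off the first rim, yet belongs to the same wheel, so it could
      only be the centre \<open>u\<close>, which is not its own neighbour.\<close>
    have "g' 0 \<in> S" using g' by auto
    moreover have "g' 0 \<in> verts H'" using H'(2) g'(1) by auto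
    moreover have "H' = H" using unique H H'(1) by blast
    ultimately have "u \<in> ?N" using vH by (auto simp: S_def)
    then show False using simple_graphD(3)[OF simple, of u u] by (auto simp: neighbours_def)
  qed
  moreover have "m = card ?R" using rim unfolding rim_of_wheel_def by (simp add: card_image)
  ultimately show thesis using that rim by metis
qed

section \<open>The semi-total point graph of a cycle inside the anti-Gallai graph\<close>

lemma cycle_graph_triangle_free:
  assumes "k \<ge> 4"
  shows "\<not> (adjacent (cycle_graph k) a b \<and> adjacent (cycle_graph k) b c \<and> adjacent (cycle_graph k) a c)"
proof -
  have "Suc i mod k = (if Suc i = k then 0 else Suc i)" if "i < k" for i using that by simp
  then show ?thesis using assms by (auto simp: cycle_graph_adjacent split: if_splits)
qed

lemma cycle_graph_simple:
  assumes "k \<ge> 3" shows "simple_graph (cycle_graph k)"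
  unfolding simple_graph_def
proof (intro conjI ballI)
  show "finite (verts (cycle_graph k))" by (simp add: cycle_graph_def)
  fix e assume "e \<in> edges (cycle_graph k)"
  then obtain i where i: "i < k" "e = {i, Suc i mod k}" by (auto simp: cycle_graph_def)
  have "Suc i mod k \<noteq> i" using i(1) assms by (cases "Suc i = k") auto
  then show "e \<subseteq> verts (cycle_graph k)" "card e = 2" using i by (auto simp: cycle_graph_def)
qed

lemma adjacent_semi_total_point:
  "adjacent (semi_total_point H) (Inl i) (Inl j) \<longleftrightarrow> adjacent H i j"
  "adjacent (semi_total_point H) (Inl i) (Inr e) \<longleftrightarrow> e \<in> edges H \<and> i \<in> e"
  "adjacent (semi_total_point H) (Inr e) (Inl i) \<longleftrightarrow> e \<in> edges H \<and> i \<in> e"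
  "\<not> adjacent (semi_total_point H) (Inr e) (Inr d)"
proof -
  have "{Inl i, Inl j :: 'a + 'a set} \<in> (`) Inl ` E \<longleftrightarrow> {i, j} \<in> E" for E :: "'a set set"
  proof
    assume "{Inl i, Inl j :: 'a + 'a set} \<in> (`) Inl ` E"
    then obtain c where "c \<in> E" "{Inl i, Inl j :: 'a + 'a set} = Inl ` c" by blast
    then have "(Inl ` {i, j} :: ('a + 'a set) set) = Inl ` c" by simp
    then show "{i, j} \<in> E" using \<open>c \<in> E\<close> inj_image_eq_iff[OF inj_Inl] by metis
  next
    assume "{i, j} \<in> E"
    then have "(Inl ` {i, j} :: ('a + 'a set) set) \<in> (`) Inl ` E" by (rule imageI)
    then show "{Inl i, Inl j :: 'a + 'a set} \<in> (`) Inl ` E" by simp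
  qed
  moreover have "{x, Inr y} \<notin> (`) Inl ` E" "{Inr y, x} \<notin> (`) Inl ` E"
    for E :: "'a set set" and x and y :: "'a set"
    by blast+
  ultimately show
    "adjacent (semi_total_point H) (Inl i) (Inl j) \<longleftrightarrow> adjacent H i j"
    "adjacent (semi_total_point H) (Inl i) (Inr e) \<longleftrightarrow> e \<in> edges H \<and> i \<in> e"
    "adjacent (semi_total_point H) (Inr e) (Inl i) \<longleftrightarrow> e \<in> edges H \<and> i \<in> e"
    "\<not> adjacent (semi_total_point H) (Inr e) (Inr d)"
    unfolding adjacent_def semi_total_point_def by (auto simp: doubleton_eq_iff)
qed

text \<open>For \<open>k = 3\<close>, two common neighbours with \<open>u\<close> force each
  neighbour of \<open>u\<close> to be adjacent to the other two. The closed neighbourhood of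
  \<open>u\<close> is then closed under adjacency, so by connectedness it contains
  \<open>w\<close>.\<close>

lemma srg_degree_gt_three:
  assumes conn: "connected_graph G" and srg: "strongly_regular G n k 2 m" and k: "k \<ge> 3"
    and u: "u \<in> verts G" and w: "w \<in> verts G" "w \<noteq> u" "\<not> adjacent G u w"
  shows "k \<ge> 4"
proof (rule ccontr)
  assume "\<not> k \<ge> 4"
  then have k3: "k = 3" using k by simp
  have simple: "simple_graph G" and reg: "regular_graph G k"
    and two: "\<And>x y. x \<in> verts G \<Longrightarrow> y \<in> verts G \<Longrightarrow> adjacent G x y \<Longrightarrow>
      card (neighbours G x \<inter> neighbours G y) = 2"
    using srg unfolding strongly_regular_def by auto
  have fin: "finite (neighbours G x)" for x
    using simple unfolding simple_graph_def neighbours_def by simp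
  have irr: "x \<notin> neighbours G x" for x
    using simple_graphD(3)[OF simple, of x x] by (auto simp: neighbours_def)
  let ?T = "insert u (neighbours G u)"
  have step: "y \<in> ?T" if x: "x \<in> ?T" and xy: "adjacent G x y" for x y
  proof (cases "x = u")
    case True
    then show ?thesis using xy simple_graphD(2)[OF simple xy] by (simp add: neighbours_def)
  next
    case False
    then have xN: "x \<in> neighbours G u" using x by simp
    then have xV: "x \<in> verts G" "adjacent G u x" by (auto simp: neighbours_def)
    have "card (neighbours G u - {x}) = 2"
      using xN fin reg u k3 by (simp add: regular_graph_def)
    then have "neighbours G u \<inter> neighbours G x = neighbours G u - {x}"
      using two[OF u xV] irr fin by (intro card_subset_eq) auto
    \<comment> \<open>\<open>u\<close> and the other two neighbours of \<open>u\<close> use up all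
      three neighbours of \<open>x\<close>.\<close>
    moreover have "insert u (neighbours G u - {x}) = neighbours G x"
    proof (rule card_subset_eq)
      show "card (insert u (neighbours G u - {x})) = card (neighbours G x)"
        using \<open>card (neighbours G u - {x}) = 2\<close> irr fin reg xV(1) k3 by (simp add: regular_graph_def)
      show "insert u (neighbours G u - {x}) \<subseteq> neighbours G x"
        using calculation u xV by (auto simp: neighbours_def adjacent_commute)
    qed (rule fin)
    moreover have "y \<in> neighbours G x"
      using xy simple_graphD(2)[OF simple xy] by (simp add: neighbours_def)
    ultimately show ?thesis by blast
  qed
  have "(adjacent G)\<^sup>*\<^sup>* u w" using conn u w(1) unfolding connected_graph_def by blast
  then have "w \<in> ?T" by (induction rule: rtranclp_induct) (use step in blast)+
  then show False using w by (auto simp: neighbours_def)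
qed

lemma semi_total_point_cycle_interlaces:
  assumes simple: "simple_graph G" and k: "k \<ge> 4"
    and g: "bij_betw g {..<k} (neighbours G u)"
    and adjg: "\<And>i j. i < k \<Longrightarrow> j < k \<Longrightarrow> adjacent G (g i) (g j) \<longleftrightarrow> adjacent (cycle_graph k) i j"
    and d: "d \<in> edges G" "\<not> d \<subseteq> insert u (neighbours G u)"
  shows "interlaces (graph_eigenvalues (semi_total_point (cycle_graph k)))
    (graph_eigenvalues (anti_gallai G))"
proof -
  let ?C = "cycle_graph k" and ?N = "neighbours G u"
  let ?R = "semi_total_point ?C" and ?D = "anti_gallai G"
  have simpleC: "simple_graph ?C" using cycle_graph_simple k by simp
  have vC: "verts ?C = {..<k}" by (simp add: cycle_graph_def)
  have inj: "inj_on g {..<k}" and gN: "\<And>i. i < k \<Longrightarrow> g i \<in> ?N"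
    using g by (auto simp: bij_betw_def)
  have uN: "u \<notin> ?N" using simple_graphD(3)[OF simple, of u u] by (auto simp: neighbours_def)
  have gu: "g i \<noteq> u" if "i < k" for i using gN[OF that] uN by metis
  have gg: "g i = g j \<longleftrightarrow> i = j" if "i < k" "j < k" for i j
    using inj that by (auto simp: inj_on_def)
  have adju: "adjacent G u (g i)" if "i < k" for i using gN[OF that] by (simp add: neighbours_def)
  have edgeC: "\<exists>i j. e = {i, j} \<and> i \<noteq> j \<and> i < k \<and> j < k \<and> adjacent ?C i j" if "e \<in> edges ?C" for e
    using simple_graph_edgeE[OF simpleC that] unfolding vC by (metis lessThan_iff)
  \<comment> \<open>Vertices of the cycle go to spokes, edges of the cycle to rim edges.\<close>
  define \<phi> where "\<phi> = case_sum (\<lambda>i. {u, g i}) (\<lambda>e. g ` e)"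
  have ue: "u \<notin> g ` e" "e \<subseteq> {..<k}" if "e \<in> edges ?C" for e
    using edgeC[OF that] gu by auto
  have vR: "verts ?R = Inl ` {..<k} \<union> Inr ` edges ?C" by (simp add: semi_total_point_def vC)
  have no: "{u, g i} \<noteq> g ` e" "g ` e \<noteq> {u, g i}" if "e \<in> edges ?C" for i e
    using ue(1)[OF that] by blast+
  have inj\<phi>: "inj_on \<phi> (verts ?R)"
  proof (rule inj_onI)
    fix x y assume "x \<in> verts ?R" "y \<in> verts ?R" "\<phi> x = \<phi> y"
    then show "x = y"
      unfolding vR \<phi>_def using no ue(2) gg gu inj_on_image_eq_iff[OF inj]
      by (auto simp: doubleton_eq_iff)
  qed
  have edge1: "{u, g i} \<in> edges G" if "i < k" for i using adju[OF that] by (simp add: adjacent_def)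
  have edge2: "g ` e \<in> edges G" if e: "e \<in> edges ?C" for e
  proof -
    obtain i j where "e = {i, j}" "i < k" "j < k" "adjacent ?C i j" using edgeC[OF e] by blast
    then show ?thesis using adjg[of i j] by (simp add: adjacent_def)
  qed
  have sub: "\<phi> ` verts ?R \<subset> verts ?D"
  proof
    show "\<phi> ` verts ?R \<subseteq> verts ?D" using edge1 edge2 by (auto simp: vR \<phi>_def anti_gallai_def)
    \<comment> \<open>All edges in the image stay inside the closed neighbourhood of
      \<open>u\<close>, which \<open>d\<close> leaves; so the copy is proper.\<close>
    have "\<phi> x \<subseteq> insert u ?N" if "x \<in> verts ?R" for x
      using that gN ue(2) by (fastforce simp: vR \<phi>_def)
    then have "d \<notin> \<phi> ` verts ?R" using d(2) by blast
    then show "\<phi> ` verts ?R \<noteq> verts ?D" using d(1) by (auto simp: anti_gallai_def)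
  qed
  have fin: "finite (verts ?D)"
  proof -
    have "edges G \<subseteq> Pow (verts G)" using simple unfolding simple_graph_def by auto
    then show ?thesis using simple finite_subset unfolding simple_graph_def by (auto simp: anti_gallai_def)
  qed
  have LL: "adjacent ?C i j \<longleftrightarrow> adjacent ?D {u, g i} {u, g j}" if ij: "i < k" "j < k" for i j
  proof
    assume a: "adjacent ?C i j"
    then have "i \<noteq> j" using simple_graphD(3)[OF simpleC] by blast
    moreover have "{u, g i, g j} \<in> triangles G"
      using a ij adju adjg by (intro triangleI[OF simple]) auto
    ultimately show "adjacent ?D {u, g i} {u, g j}"
      unfolding adjacent_anti_gallai using ij edge1 gg gu
      by (auto simp: doubleton_eq_iff intro!: bexI[of _ "{u, g i, g j}"])
  next
    assume "adjacent ?D {u, g i} {u, g j}"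
    then obtain T where "T \<in> triangles G" "g i \<in> T" "g j \<in> T" "{u, g i} \<noteq> {u, g j}"
      unfolding adjacent_anti_gallai by blast
    then have "T \<in> triangles G" "g i \<in> T" "g j \<in> T" "g i \<noteq> g j" by auto
    then have "adjacent G (g i) (g j)" unfolding triangles_def by auto
    then show "adjacent ?C i j" using adjg ij by simp
  qed
  have LR: "i \<in> e \<longleftrightarrow> adjacent ?D {u, g i} (g ` e)" if i: "i < k" and e: "e \<in> edges ?C" for i e
  proof -
    obtain a b where ab: "e = {a, b}" "a \<noteq> b" "a < k" "b < k" "adjacent ?C a b" using edgeC[OF e] by blast
    show ?thesis
    proof
      assume "i \<in> e"
      moreover have "{u, g a, g b} \<in> triangles G"
        using ab adju adjg by (intro triangleI[OF simple]) auto
      moreover have "{u, g i} \<noteq> g ` e" using ue[OF e] by auto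
      ultimately show "adjacent ?D {u, g i} (g ` e)"
        unfolding adjacent_anti_gallai using i edge1 edge2[OF e] ab(1)
        by (intro conjI bexI[of _ "{u, g a, g b}"]) auto
    next
      assume "adjacent ?D {u, g i} (g ` e)"
      then obtain T where T: "T \<in> triangles G" "u \<in> T" "g i \<in> T" "g a \<in> T" "g b \<in> T"
        unfolding adjacent_anti_gallai using ab(1) by auto
      have "g a \<noteq> g b" using gg ab by simp
      \<comment> \<open>The triangle consists of the rim edge and one more vertex, which must be
        \<open>u\<close>; thus \<open>g i\<close> is an end of the rim edge.\<close>
      then obtain z where "T = {g a, g b, z}" using triangle_through_edge[OF T(1,4,5)] by blast
      then have "g i = g a \<or> g i = g b" using T gu i ab by auto
      then show "i \<in> e" using gg i ab by auto
    qed
  qed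
  have RR: "\<not> adjacent ?D (g ` e) (g ` f)" if e: "e \<in> edges ?C" and f: "f \<in> edges ?C" for e f
  proof
    assume a: "adjacent ?D (g ` e) (g ` f)"
    obtain a b where ab: "e = {a, b}" "a \<noteq> b" "a < k" "b < k" using edgeC[OF e] by blast
    have "e \<noteq> f" using a unfolding adjacent_anti_gallai by auto
    obtain i j where ij: "f = {i, j}" "i \<noteq> j" "i < k" "j < k" using edgeC[OF f] by blast
    \<comment> \<open>Two distinct edges cover at least three vertices, so a triangle of
      \<open>G\<close> containing both would pull back to a triangle in the cycle, impossible for
      \<open>k \<ge> 4\<close>.\<close>
    obtain c where c: "c \<in> f" "c \<noteq> a" "c \<noteq> b" using \<open>e \<noteq> f\<close> ab(1) ij(1,2) by blast
    then have "c < k" using ij by auto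
    obtain T where T: "T \<in> triangles G" "g a \<in> T" "g b \<in> T" "g c \<in> T"
      using a c(1) unfolding adjacent_anti_gallai ab(1) by auto
    then have "adjacent G (g a) (g b)" "adjacent G (g b) (g c)" "adjacent G (g a) (g c)"
      using gg ab c \<open>c < k\<close> unfolding triangles_def by auto
    then show False
      using cycle_graph_triangle_free[OF k, of a b c] adjg ab(3,4) \<open>c < k\<close> by simp
  qed
  have "adjacent ?R x y \<longleftrightarrow> adjacent ?D (\<phi> x) (\<phi> y)" if "x \<in> verts ?R" "y \<in> verts ?R" for x y
    using that unfolding vR \<phi>_def
    by (auto simp: adjacent_semi_total_point LL LR RR adjacent_commute[of ?D "g ` _" "{u, g _}"]
      simp del: image_insert)
  then show ?thesis by (rule induced_subgraph_interlaces[OF fin inj\<phi> sub])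
qed

theorem theorem9:
  fixes G :: "'a ugraph" and n k \<mu> :: nat
  assumes "connected_graph G"
    and "strongly_regular G n k 2 \<mu>"
    and "k \<ge> 3"
    and "\<forall>u\<in>verts G. \<exists>!H. wheel_in G u H"
  shows "(\<forall>\<theta>. eigenvalue (adj_matrix (anti_gallai G)) \<theta> \<longrightarrow> \<theta> \<in> {-4..4}) \<and>
    interlaces (graph_eigenvalues (semi_total_point (cycle_graph k)))
               (graph_eigenvalues (anti_gallai G))"
proof (intro conjI allI impI)
  have simple: "simple_graph G" and reg: "regular_graph G k" and "\<not> complete_graph G"
    and two: "\<And>x y. x \<in> verts G \<Longrightarrow> y \<in> verts G \<Longrightarrow> adjacent G x y \<Longrightarrow>
      card (neighbours G x \<inter> neighbours G y) = 2"
    using assms(2) unfolding strongly_regular_def by auto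
  {
    fix \<theta> assume ev: "eigenvalue (adj_matrix (anti_gallai G)) \<theta>"
    have "edges G \<subseteq> Pow (verts G)" using simple unfolding simple_graph_def by auto
    then have "finite (verts (anti_gallai G))"
      using simple finite_subset unfolding simple_graph_def by (auto simp: anti_gallai_def)
    moreover have "card (neighbours (anti_gallai G) e) \<le> 4" if "e \<in> verts (anti_gallai G)" for e
      using anti_gallai_degree_le[OF assms(2)] that by (simp add: anti_gallai_def)
    ultimately have "\<bar>\<theta>\<bar> \<le> 4"
      using adj_matrix_eigenvalue_bound[of "anti_gallai G" 4 \<theta>] ev by simp
    then show "\<theta> \<in> {-4..4}" by (simp add: abs_le_iff)
  }
  \<comment> \<open>The non-neighbour \<open>w\<close> serves twice: it rules out
    \<open>k = 3\<close>, and any edge at \<open>w\<close> leaves the closed neighbourhood of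
    \<open>u\<close>.\<close>
  obtain u w where u: "u \<in> verts G" and w: "w \<in> verts G" "w \<noteq> u" "\<not> adjacent G u w"
    using \<open>\<not> complete_graph G\<close> unfolding complete_graph_def by metis
  let ?N = "neighbours G u"
  have cardN: "card ?N = k" using reg u by (simp add: regular_graph_def)
  have two_u: "card (?N \<inter> neighbours G x) = 2" if "x \<in> ?N" for x
    using two u that by (simp add: neighbours_def)
  obtain g where rim: "rim_of_wheel G u k g" and im: "g ` {..<k} = ?N"
    using unique_wheel_rim[OF simple u two_u] assms(4) u cardN by metis
  have inj: "inj_on g {..<k}" using rim by (simp add: rim_of_wheel_def)
  \<comment> \<open>By \<open>rim_neighbour\<close> the rim has no chords, so the neighbourhood of
    \<open>u\<close> induces exactly the cycle.\<close>
  have adjg: "adjacent G (g i) (g j) \<longleftrightarrow> adjacent (cycle_graph k) i j" if ij: "i < k" "j < k" for i j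
  proof
    assume "adjacent G (g i) (g j)"
    moreover have "g j \<in> ?N" using im ij by auto
    ultimately obtain l where "l < k" "g j = g l" "l = Suc i mod k \<or> i = Suc l mod k"
      using rim_neighbour[OF simple rim two_u ij(1)] by blast
    then show "adjacent (cycle_graph k) i j"
      using ij inj by (auto simp: cycle_graph_adjacent inj_on_def)
  next
    assume "adjacent (cycle_graph k) i j"
    then show "adjacent G (g i) (g j)"
      using rim ij adjacent_commute[of G "g i"] unfolding cycle_graph_adjacent rim_of_wheel_def by metis
  qed
  have "card (neighbours G w) = k" using reg w(1) by (simp add: regular_graph_def)
  then obtain z where "z \<in> neighbours G w" using assms(3) by fastforce
  then have d: "{w, z} \<in> edges G" "\<not> {w, z} \<subseteq> insert u ?N"
    using w by (auto simp: neighbours_def adjacent_def)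
  show "interlaces (graph_eigenvalues (semi_total_point (cycle_graph k)))
      (graph_eigenvalues (anti_gallai G))"
    using semi_total_point_cycle_interlaces[OF simple srg_degree_gt_three[OF assms(1-3) u w] _ adjg d]
      inj im by (simp add: bij_betw_def)
qed

end
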